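(* Let $k \geq 1$ be an integer. Then the function $t \mapsto \sin(2kt)$ on $\mathbb{R}$ cannot be represented as a naive trigonometric polynomial; that is, there do not exist a nonnegative integer $N$ and complex numbers $\alpha_0, \ldots, \alpha_N, \beta_1, \ldots, \beta_N \in \mathbb{C}$ such that $\sin(2kt) = \sum_{n=0}^{N} \alpha_n \cos^n(t) + \sum_{n=1}^{N} \beta_n \sin^n(t)$ for all $t \in \mathbb{R}$.
   Context: A naive trigonometric polynomial is a function $g \in C^\infty(\mathbb{R},\mathbb{C})$ of the form $g(t) = \sum_{n=0}^{N} \alpha_n \cos^n(t) + \sum_{n=1}^{N} \beta_n \sin^n(t)$ for some nonnegative integer $N$ and complex numbers $\alpha_0, \ldots, \alpha_N, \beta_1, \ldots, \beta_N \in \mathbb{C}$. Here $\cos^n(t) = (\cos t)^n$ and $\sin^n(t) = (\sin t)^n$, with $\cos^0(t) = 1$. *)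

theory Defs
  imports Complex_Main
begin

(* No separate smoothness condition is imposed: every function of this form is smooth. *)
definition naive_trig_poly :: "(real \<Rightarrow> complex) \<Rightarrow> bool" where
  "naive_trig_poly g \<longleftrightarrow>
     (\<exists>(N::nat) (\<alpha>::nat \<Rightarrow> complex) (\<beta>::nat \<Rightarrow> complex). \<forall>t::real.
        g t = (\<Sum>n=0..N. \<alpha> n * complex_of_real (cos t ^ n))
            + (\<Sum>n=1..N. \<beta> n * complex_of_real (sin t ^ n)))"

end

(* In a naive trigonometric polynomial, the difference g t - g (- t) depends on sin t alone, so it
   is invariant under t \<mapsto> pi - t. For g t = sin (2 k t) that difference changes
   sign under this reflection, so it would have to vanish; at t = pi / (4 k) it equals 2. *)
theory Submission
  imports Defs
begin

text \<open>The cosine sums cancel within each difference, \<open>cos\<close> being even; the sine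
  sums left over agree because \<open>sin (pi - t) = sin t\<close>.\<close>

lemma naive_trig_poly_reflection:
  assumes "naive_trig_poly g"
  shows "g t - g (- t) = g (pi - t) - g (t - pi)"
proof -
  obtain N \<alpha> \<beta> where g: "g t = (\<Sum>n=0..N. \<alpha> n * complex_of_real (cos t ^ n))
      + (\<Sum>n=1..N. \<beta> n * complex_of_real (sin t ^ n))" for t
    using assms unfolding naive_trig_poly_def by blast
  have "cos (pi - t) = - cos t" "cos (t - pi) = - cos t"
    and "sin (pi - t) = sin t" "sin (t - pi) = - sin t"
    by (simp_all add: cos_diff sin_diff)
  then show ?thesis
    unfolding g by simp
qed

theorem proposition3:
  fixes k :: nat
  assumes "k \<ge> 1"
  shows "\<not> naive_trig_poly (\<lambda>t::real. complex_of_real (sin (2 * real k * t)))"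
proof
  let ?f = "\<lambda>t::real. sin (2 * real k * t)"
  define t where "t = pi / (4 * real k)"
  assume "naive_trig_poly (\<lambda>t. complex_of_real (?f t))"
  from naive_trig_poly_reflection[OF this, of t]
  have eq: "?f t - ?f (- t) = ?f (pi - t) - ?f (t - pi)"
    by (metis of_real_diff of_real_eq_iff)
  \<comment> \<open>For \<open>k = 0\<close> this fails: division by zero would give
    \<open>t = 0\<close>.\<close>
  have arg: "2 * real k * t = pi / 2"
    using assms by (simp add: t_def)
  have args: "2 * real k * (pi - t) = 2 * real k * pi - pi / 2"
    "2 * real k * (t - pi) = pi / 2 - 2 * real k * pi"
    using arg by (simp_all add: right_diff_distrib)
  \<comment> \<open>The even frequency enters here: for an odd one the cosine would be -1 and the
    sign would not change.\<close>
  have period: "sin (2 * real k * pi) = 0" "cos (2 * real k * pi) = 1"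
    using sin_2npi[of k] cos_2npi[of k] by (simp_all add: mult.commute mult.left_commute)
  \<comment> \<open>Now \<open>eq\<close> reads 2 = -2.\<close>
  show False
    using eq unfolding args by (simp add: arg sin_diff period)
qed

end
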